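(* Let $n\ge 1$. The concise flag vectors $f^cG$, as $G$ ranges over all graphs on $n$ vertices, are an integral spanning set for the formal sums of partitions of $n$; that is, every formal sum of partitions of $n$ with integer coefficients is an integer linear combination of vectors $f^cG$ with $G$ a graph on $n$ vertices.
   Context: Graphs are finite and simple. "Subgraph of $G$" means a graph with the same vertex set as $G$ and edge set a subset of that of $G$. For a graph $H$ on $n$ vertices, $\pi(H)$ is the partition of the integer $n$ given by the sizes of the connected components of $H$. For a tree $T$ on $m\ge 3$ vertices, $s(T)$ is the number of ways of shelling $T$ down to a 3-vertex tree (sequences of $m-3$ vertices removed one at a time, each being a leaf of the remaining tree when removed); for a tree on at most 3 vertices $s(T)=1$. For an acyclic graph $H$ with component trees $T_1,\dots,T_r$, $s(H)=s(T_1)\cdots s(T_r)$; if $H$ contains a cycle, $s(H)=0$. The concise flag vector of a graph $G$ on $n$ vertices is $f^cG=\sum_H s(H)\,\pi(H)$, the sum over all subgraphs $H$ of $G$, an element of the free abelian group on the set of partitions of $n$. *)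

theory Defs
  imports "HOL-Library.Multiset" "HOL-Algebra.Free_Abelian_Groups"
begin

record 'v graph =
  verts :: "'v set"
  edges :: "'v set set"

definition simple_graph :: "'v graph \<Rightarrow> bool" where
  "simple_graph G \<longleftrightarrow> finite (verts G) \<and> edges G \<subseteq> {e. e \<subseteq> verts G \<and> card e = 2}"

definition graphs_on :: "nat \<Rightarrow> 'v graph set" where
  "graphs_on n = {G. simple_graph G \<and> card (verts G) = n}"

definition subgraphs :: "'v graph \<Rightarrow> 'v graph set" where
  "subgraphs G = {H. verts H = verts G \<and> edges H \<subseteq> edges G}"

definition adjacency :: "'v graph \<Rightarrow> ('v \<times> 'v) set" where
  "adjacency G = {(u, v). {u, v} \<in> edges G}"

definition components :: "'v graph \<Rightarrow> 'v set set" where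
  "components G = {{w \<in> verts G. (v, w) \<in> (adjacency G)\<^sup>*} | v. v \<in> verts G}"

definition induced :: "'v graph \<Rightarrow> 'v set \<Rightarrow> 'v graph" where
  "induced G C = \<lparr>verts = C, edges = {e \<in> edges G. e \<subseteq> C}\<rparr>"

definition is_cycle :: "'v graph \<Rightarrow> 'v list \<Rightarrow> bool" where
  "is_cycle G p \<longleftrightarrow> 3 \<le> length p \<and> distinct p \<and>
     (\<forall>i < length p. {p ! i, p ! (Suc i mod length p)} \<in> edges G)"

definition acyclic_graph :: "'v graph \<Rightarrow> bool" where
  "acyclic_graph G \<longleftrightarrow> (\<nexists>p. is_cycle G p)"

definition leaf :: "'v graph \<Rightarrow> 'v \<Rightarrow> bool" where
  "leaf G v \<longleftrightarrow> v \<in> verts G \<and> card {e \<in> edges G. v \<in> e} = 1"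

fun shelling :: "'v graph \<Rightarrow> 'v list \<Rightarrow> bool" where
  "shelling T [] \<longleftrightarrow> True"
| "shelling T (v # vs) \<longleftrightarrow> leaf T v \<and> shelling (induced T (verts T - {v})) vs"

text \<open>Only meaningful when the argument is a tree; removing leaves from a tree leaves a tree,
  so a shelling of the length below does end in a tree on three vertices.\<close>

definition tree_shellings :: "'v graph \<Rightarrow> nat" where
  "tree_shellings T =
     (if card (verts T) \<le> 3 then 1
      else card {vs. length vs = card (verts T) - 3 \<and> shelling T vs})"

definition shellings :: "'v graph \<Rightarrow> nat" where
  "shellings H =
     (if acyclic_graph H then \<Prod>C\<in>components H. tree_shellings (induced H C) else 0)"

definition partitions :: "nat \<Rightarrow> nat multiset set" where
  "partitions n = {p. 0 \<notin># p \<and> sum_mset p = n}"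

definition component_partition :: "'v graph \<Rightarrow> nat multiset" where
  "component_partition H = image_mset card (mset_set (components H))"

definition concise_flag_vector :: "'v graph \<Rightarrow> nat multiset \<Rightarrow>\<^sub>0 int" where
  "concise_flag_vector G =
     (\<Sum>H\<in>subgraphs G. frag_cmul (int (shellings H)) (frag_of (component_partition H)))"

end

theory Submission
  imports Defs
begin

text \<open>
  Two observations carry the proof.

  Within the set of all graphs on a fixed vertex set, the vector of \<open>G\<close> is a sum over the subgraphs
  of \<open>G\<close> in which the term of \<open>G\<close> itself is \<open>s(G) \<pi>(G)\<close>, while the other terms belong to graphs with
  fewer edges. This triangular system inverts over the integers, so the span of the flag vectors
  contains \<open>s(G) \<pi>(G)\<close> for every \<open>G\<close> (\<open>shellings_in_flag_span\<close>). Hence it is enough to find, for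
  every partition \<open>\<lambda>\<close> of \<open>n\<close>, forests with component sizes \<open>\<lambda>\<close> whose shelling numbers have greatest
  common divisor 1.

  Two forests suffice (\<open>coprime_forests\<close>). In the first every component is a path, in the second
  every component is a fork: a path with one more vertex attached to the neighbour of one of its
  ends. A path on at least two vertices has two leaves, and removing either leaves a path, so its
  number of shellings is a power of 2 (\<open>shelling_count_path\<close>). A fork on more than three vertices has
  three leaves. Removing either of the two twin leaves gives a path, and removing the third gives a
  shorter fork; as the two paths have equally many shellings, the parity of the number of shellings
  is that of the shorter fork, and so it is odd by induction (\<open>shelling_count_fork\<close>). Components on
  at most three vertices contribute the factor 1, which is both odd and a power of 2. The product
  over the components is therefore a power of 2 for the paths and odd for the forks, and by Bezout
  the two multiples of \<open>\<lambda>\<close> generate \<open>\<lambda>\<close>.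
\<close>

section \<open>Components of a graph\<close>

lemma adjacency_rtrancl_sym: "(u, v) \<in> (adjacency G)\<^sup>* \<Longrightarrow> (v, u) \<in> (adjacency G)\<^sup>*"
proof -
  have "sym (adjacency G)"
    by (auto simp: sym_def adjacency_def insert_commute)
  then show "(u, v) \<in> (adjacency G)\<^sup>* \<Longrightarrow> (v, u) \<in> (adjacency G)\<^sup>*"
    by (meson sym_rtrancl symD)
qed

lemma components_disjoint:
  assumes "C \<in> components G" "D \<in> components G" "C \<noteq> D"
  shows "C \<inter> D = {}"
proof (rule ccontr)
  assume "C \<inter> D \<noteq> {}"
  then obtain w where w: "w \<in> C" "w \<in> D" by blast
  obtain c where C: "C = {x \<in> verts G. (c, x) \<in> (adjacency G)\<^sup>*}"
    using assms(1) by (auto simp: components_def)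
  obtain d where D: "D = {x \<in> verts G. (d, x) \<in> (adjacency G)\<^sup>*}"
    using assms(2) by (auto simp: components_def)
  have "(c, d) \<in> (adjacency G)\<^sup>*" "(d, c) \<in> (adjacency G)\<^sup>*"
    using w C D adjacency_rtrancl_sym rtrancl_trans by (metis (no_types, lifting) mem_Collect_eq)+
  then have "C = D"
    unfolding C D by (auto intro: rtrancl_trans)
  with assms(3) show False by simp
qed

lemma Union_components: "\<Union> (components G) = verts G"
  by (auto simp: components_def)

lemma component_partition_in_partitions:
  assumes "finite (verts G)"
  shows "component_partition G \<in> partitions (card (verts G))"
proof -
  have fin: "finite (components G)"
    using assms Union_components[of G] by (metis finite_UnionD)
  have fin': "finite C" if "C \<in> components G" for C
    using that assms by (auto simp: components_def)
  have ne: "C \<noteq> {}" if "C \<in> components G" for C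
    using that by (auto simp: components_def)
  have "sum card (components G) = card (\<Union> (components G))"
    by (rule card_Union_disjoint[symmetric])
       (auto simp: fin' pairwise_def disjnt_def dest: components_disjoint)
  moreover have "0 \<notin># component_partition G"
    using fin fin' ne by (auto simp: component_partition_def)
  ultimately show ?thesis
    by (simp add: partitions_def component_partition_def Union_components
        flip: sum_unfold_sum_mset)
qed

text \<open>A partition into connected blocks without edges between different blocks is the partition
  into components.\<close>

lemma components_eqI:
  assumes cover: "\<Union> P = verts G"
    and connected: "\<And>B u v. B \<in> P \<Longrightarrow> u \<in> B \<Longrightarrow> v \<in> B \<Longrightarrow> (u, v) \<in> (adjacency G)\<^sup>*"
    and separate: "\<And>B u v. B \<in> P \<Longrightarrow> u \<in> B \<Longrightarrow> {u, v} \<in> edges G \<Longrightarrow> v \<in> B"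
    and nonempty: "{} \<notin> P"
  shows "components G = P"
proof -
  have reach: "{w \<in> verts G. (v, w) \<in> (adjacency G)\<^sup>*} = B" if "B \<in> P" "v \<in> B" for v B
  proof -
    have "w \<in> B" if "(v, w) \<in> (adjacency G)\<^sup>*" for w
      using that
    proof (induction rule: rtrancl_induct)
      case base
      show ?case by (fact \<open>v \<in> B\<close>)
    next
      case (step x y)
      then show ?case using separate[OF \<open>B \<in> P\<close>] by (auto simp: adjacency_def)
    qed
    then show ?thesis using cover connected that by blast
  qed
  show ?thesis
  proof
    show "components G \<subseteq> P"
    proof
      fix C assume "C \<in> components G"
      then obtain v where v: "v \<in> verts G" "C = {w \<in> verts G. (v, w) \<in> (adjacency G)\<^sup>*}"
        by (auto simp: components_def)
      then obtain B where "B \<in> P" "v \<in> B" using cover by blast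
      then show "C \<in> P" using reach v by auto
    qed
    show "P \<subseteq> components G"
    proof
      fix B assume B: "B \<in> P"
      then obtain v where "v \<in> B" using nonempty by (metis ex_in_conv)
      moreover have "v \<in> verts G" using B \<open>v \<in> B\<close> cover by blast
      ultimately show "B \<in> components G" using reach[OF B] by (auto simp: components_def)
    qed
  qed
qed

section \<open>Acyclicity from an ordering of the vertices\<close>

definition larger_neighbours_unique :: "'a::linorder set set \<Rightarrow> bool" where
  "larger_neighbours_unique E \<longleftrightarrow>
    (\<forall>u v w. {u, v} \<in> E \<longrightarrow> {u, w} \<in> E \<longrightarrow> u < v \<longrightarrow> u < w \<longrightarrow> v = w)"

lemma larger_neighbours_uniqueD:
  "larger_neighbours_unique E \<Longrightarrow> {u, v} \<in> E \<Longrightarrow> {u, w} \<in> E \<Longrightarrow> u < v \<Longrightarrow> u < w \<Longrightarrow> v = w"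
  unfolding larger_neighbours_unique_def by blast

lemma larger_neighbours_unique_insert:
  assumes unique: "larger_neighbours_unique E" and "x < y" and least: "\<And>a. a \<in> \<Union> E \<Longrightarrow> x < a"
  shows "larger_neighbours_unique (insert {x, y} E)"
  unfolding larger_neighbours_unique_def
proof (intro allI impI)
  fix u v w
  assume e: "{u, v} \<in> insert {x, y} E" "{u, w} \<in> insert {x, y} E" and less: "u < v" "u < w"
  show "v = w"
  proof (cases "u = x")
    case True
    have "{u, v} \<notin> E" "{u, w} \<notin> E" using least[of u] True by auto
    then show ?thesis using e True by (auto simp: doubleton_eq_iff)
  next
    case False
    then have "{u, v} \<noteq> {x, y}" "{u, w} \<noteq> {x, y}"
      using less \<open>x < y\<close> by (auto simp: doubleton_eq_iff)
    then show ?thesis using e less larger_neighbours_uniqueD[OF unique] by blast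
  qed
qed

text \<open>On a cycle the least vertex would have two larger neighbours.\<close>

lemma acyclic_graphI:
  fixes G :: "'a::linorder graph"
  assumes unique: "larger_neighbours_unique (edges G)"
  shows "acyclic_graph G"
  unfolding acyclic_graph_def
proof
  assume "\<exists>p. is_cycle G p"
  then obtain p where len: "3 \<le> length p" and dist: "distinct p"
    and edge: "\<And>i. i < length p \<Longrightarrow> {p ! i, p ! (Suc i mod length p)} \<in> edges G"
    by (auto simp: is_cycle_def)
  have "Min (set p) \<in> set p" using len by (intro Min_in) auto
  then obtain i where i: "i < length p" "p ! i = Min (set p)" by (auto simp: in_set_conv_nth)
  define j where "j = Suc i mod length p"
  define k where "k = (if i = 0 then length p - 1 else i - 1)"
  have j_cases: "j = (if Suc i = length p then 0 else Suc i)"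
    using i(1) by (auto simp: j_def)
  with i(1) have j: "j < length p" by auto
  have k: "k < length p" "Suc k mod length p = i"
    using i len by (auto simp: k_def)
  have ne: "j \<noteq> i" "k \<noteq> i" "j \<noteq> k" using i len j_cases k_def by (auto split: if_splits)
  have larger: "p ! i < p ! l" if "l < length p" "l \<noteq> i" for l
    using that i dist by (metis List.finite_set Min_le nat_less_le nth_eq_iff_index_eq nth_mem order_less_le)
  have "{p ! i, p ! j} \<in> edges G" using edge[OF i(1)] by (simp add: j_def)
  moreover have "{p ! i, p ! k} \<in> edges G" using edge[OF k(1)] k(2) by (simp add: insert_commute)
  ultimately have "p ! j = p ! k" using larger_neighbours_uniqueD[OF unique] larger j k(1) ne by blast
  then show False using dist j k(1) ne(3) by (simp add: nth_eq_iff_index_eq)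
qed

section \<open>Counting shellings leaf by leaf\<close>

text \<open>The number of removals is a parameter of its own, not tied to stopping at three vertices. The
  recurrence by the first removed leaf then holds for every finite graph, and it lowers only this
  parameter.\<close>

definition shelling_count :: "'v graph \<Rightarrow> nat \<Rightarrow> nat" where
  "shelling_count T k = card {vs. length vs = k \<and> shelling T vs}"

lemma shelling_subset_verts: "shelling T vs \<Longrightarrow> set vs \<subseteq> verts T"
  by (induction T vs rule: shelling.induct) (auto simp: leaf_def induced_def)

lemma finite_shellings: "finite (verts T) \<Longrightarrow> finite {vs. length vs = k \<and> shelling T vs}"
  by (rule finite_subset[OF _ finite_lists_length_eq[of "verts T" k]])
     (auto dest: shelling_subset_verts)

lemma shelling_count_0: "shelling_count T 0 = 1"
proof -
  have "{vs. length vs = 0 \<and> shelling T vs} = {[]}" by auto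
  then show ?thesis by (simp add: shelling_count_def)
qed

lemma shelling_count_Suc:
  assumes "finite (verts T)"
  shows "shelling_count T (Suc k) =
    (\<Sum>v | leaf T v. shelling_count (induced T (verts T - {v})) k)"
proof -
  let ?S = "\<lambda>v. {vs. length vs = k \<and> shelling (induced T (verts T - {v})) vs}"
  have fin: "finite {v. leaf T v}"
    by (rule finite_subset[OF _ assms]) (auto simp: leaf_def)
  have "{vs. length vs = Suc k \<and> shelling T vs} = (\<Union>v\<in>{v. leaf T v}. (#) v ` ?S v)"
    by (auto simp: length_Suc_conv)
  moreover have "card (\<Union>v\<in>{v. leaf T v}. (#) v ` ?S v) = (\<Sum>v | leaf T v. card ((#) v ` ?S v))"
    using fin assms by (intro card_UN_disjoint) (auto intro!: finite_imageI finite_shellings simp: induced_def)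
  ultimately show ?thesis
    by (simp add: shelling_count_def card_image)
qed

lemma tree_shellings_eq_shelling_count: "tree_shellings T = shelling_count T (card (verts T) - 3)"
proof (cases "card (verts T) \<le> 3")
  case True
  then show ?thesis by (simp add: tree_shellings_def shelling_count_0)
qed (simp add: tree_shellings_def shelling_count_def)

lemma leaf_attached:
  assumes "\<Union> E \<subseteq> V" "v \<notin> V"
  shows "leaf \<lparr>verts = insert v V, edges = insert {u, v} E\<rparr> v"
proof -
  have "{e \<in> insert {u, v} E. v \<in> e} = {{u, v}}" using assms by auto
  then show ?thesis by (simp add: leaf_def)
qed

lemma induced_detach:
  assumes "\<Union> E \<subseteq> V" "v \<notin> V"
  shows "induced \<lparr>verts = insert v V, edges = insert {u, v} E\<rparr> (insert v V - {v})
    = \<lparr>verts = V, edges = E\<rparr>"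
proof -
  have "{e \<in> insert {u, v} E. e \<subseteq> V} = E" using assms by auto
  then show ?thesis using assms(2) by (simp add: induced_def)
qed

lemma not_leaf_two_neighbours:
  assumes "{u, v} \<in> edges G" "{v, w} \<in> edges G" "u \<noteq> w"
  shows "\<not> leaf G v"
proof
  assume "leaf G v"
  then obtain e where "{e \<in> edges G. v \<in> e} = {e}"
    by (auto simp: leaf_def card_1_singleton_iff)
  moreover have "{u, v} \<in> {e \<in> edges G. v \<in> e}" "{v, w} \<in> {e \<in> edges G. v \<in> e}"
    using assms by simp_all
  ultimately have "{u, v} = {v, w}" by simp
  then show False using assms(3) by (auto simp: doubleton_eq_iff)
qed

section \<open>Paths have a power of 2 of shellings\<close>

fun path_edges :: "'a list \<Rightarrow> 'a set set" where
  "path_edges (x # y # zs) = insert {x, y} (path_edges (y # zs))"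
| "path_edges _ = {}"

lemma Union_path_edges: "\<Union> (path_edges xs) \<subseteq> set xs"
  by (induction xs rule: path_edges.induct) auto

lemma path_edges_snoc: "path_edges (xs @ [y, z]) = insert {y, z} (path_edges (xs @ [y]))"
proof (induction xs)
  case (Cons x xs)
  then show ?case by (cases xs) auto
qed simp

lemma path_edges_append: "{u, v} \<in> path_edges (xs @ u # v # ys)"
proof (induction xs)
  case (Cons x xs)
  then show ?case by (cases xs) auto
qed simp

lemma path_interior_neighbours:
  assumes "distinct xs" "v \<in> set xs" "v \<noteq> hd xs" "v \<noteq> last xs"
  obtains u w where "{u, v} \<in> path_edges xs" "{v, w} \<in> path_edges xs" "u \<noteq> w"
proof -
  obtain as bs where xs: "xs = as @ v # bs" using assms(2) by (auto simp: in_set_conv_decomp)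
  obtain as' u where as: "as = as' @ [u]" using assms(3) xs by (cases as rule: rev_cases) auto
  obtain w bs' where bs: "bs = w # bs'" using assms(4) xs by (cases bs) auto
  show thesis
  proof (rule that)
    show "{u, v} \<in> path_edges xs" using path_edges_append[of u v as'] by (simp add: xs as)
    show "{v, w} \<in> path_edges xs" using path_edges_append[of v w as] by (simp add: xs bs)
    show "u \<noteq> w" using assms(1) by (auto simp: xs as bs)
  qed
qed

lemma two_last_entries:
  assumes "2 \<le> length xs"
  obtains ws v z where "xs = ws @ [v, z]"
proof (cases xs rule: rev_cases)
  case (snoc us z)
  then show thesis using assms that by (cases us rule: rev_cases) auto
qed (use assms in simp)

definition list_graph :: "('a list \<Rightarrow> 'a set set) \<Rightarrow> 'a list \<Rightarrow> 'a graph" where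
  "list_graph E xs = \<lparr>verts = set xs, edges = E xs\<rparr>"

lemma path_detach_hd:
  assumes "distinct (x # y # zs)"
  shows "leaf (list_graph path_edges (x # y # zs)) x"
    and "induced (list_graph path_edges (x # y # zs)) (set (x # y # zs) - {x})
      = list_graph path_edges (y # zs)"
  using leaf_attached[of "path_edges (y # zs)" "set (y # zs)" x y]
    induced_detach[of "path_edges (y # zs)" "set (y # zs)" x y]
    Union_path_edges[of "y # zs"] assms
  by (simp_all add: list_graph_def insert_commute)

lemma path_detach_last:
  assumes "distinct (xs @ [y, z])"
  shows "leaf (list_graph path_edges (xs @ [y, z])) z"
    and "induced (list_graph path_edges (xs @ [y, z])) (set (xs @ [y, z]) - {z})
      = list_graph path_edges (xs @ [y])"
proof -
  have "set (xs @ [y, z]) = insert z (set (xs @ [y]))" by auto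
  then have eq: "list_graph path_edges (xs @ [y, z])
      = \<lparr>verts = insert z (set (xs @ [y])), edges = insert {y, z} (path_edges (xs @ [y]))\<rparr>"
    by (simp only: list_graph_def path_edges_snoc)
  show "leaf (list_graph path_edges (xs @ [y, z])) z"
    unfolding eq using assms Union_path_edges[of "xs @ [y]"] by (intro leaf_attached) auto
  show "induced (list_graph path_edges (xs @ [y, z])) (set (xs @ [y, z]) - {z})
      = list_graph path_edges (xs @ [y])"
    using induced_detach[of "path_edges (xs @ [y])" "set (xs @ [y])" z y]
      assms Union_path_edges[of "xs @ [y]"]
    unfolding eq \<open>set (xs @ [y, z]) = _\<close> by (auto simp: list_graph_def)
qed

text \<open>The bound on \<open>k\<close> ensures that before each removal the path still has at least two vertices, so
  that its two ends are distinct and both are leaves.\<close>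

lemma shelling_count_path:
  assumes "distinct xs" "k + 2 \<le> length xs"
  shows "shelling_count (list_graph path_edges xs) k = 2 ^ k"
  using assms
proof (induction k arbitrary: xs)
  case 0
  show ?case by (simp add: shelling_count_0)
next
  case (Suc k)
  let ?T = "list_graph path_edges xs"
  obtain x y zs where xs: "xs = x # y # zs"
    using Suc.prems(2) by (auto simp: Suc_le_length_iff numeral_2_eq_2)
  obtain ws v z where xs': "xs = ws @ [v, z]"
    using two_last_entries[of xs] Suc.prems(2) by auto
  have leaves: "{v. leaf ?T v} = {x, z}"
  proof -
    have "\<not> leaf ?T v" if v: "v \<noteq> x" "v \<noteq> z" for v
    proof (cases "v \<in> set xs")
      case True
      obtain u w where "{u, v} \<in> path_edges xs" "{v, w} \<in> path_edges xs" "u \<noteq> w"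
      proof (rule path_interior_neighbours[OF Suc.prems(1) True])
        show "v \<noteq> hd xs" using v by (simp add: xs)
        show "v \<noteq> last xs" using v by (simp add: xs')
      qed
      then show ?thesis by (intro not_leaf_two_neighbours) (simp_all add: list_graph_def)
    qed (simp add: leaf_def list_graph_def)
    moreover have "leaf ?T x" using path_detach_hd(1) Suc.prems(1) by (simp add: xs)
    moreover have "leaf ?T z" using path_detach_last(1) Suc.prems(1) by (metis xs')
    ultimately show ?thesis by blast
  qed
  have "last (y # zs) = last xs" by (simp add: xs)
  also have "\<dots> = z" by (simp add: xs')
  finally have "z \<in> set (y # zs)" by (metis last_in_set list.distinct(1))
  then have "x \<noteq> z" using Suc.prems(1) by (auto simp: xs)
  have vT: "verts ?T = set xs" by (simp add: list_graph_def)
  have "shelling_count (induced ?T (verts ?T - {x})) k = 2 ^ k"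
    unfolding vT using Suc path_detach_hd(2)[of x y zs] by (simp add: xs)
  moreover have "shelling_count (induced ?T (verts ?T - {z})) k = 2 ^ k"
  proof -
    have "shelling_count (list_graph path_edges (ws @ [v])) k = 2 ^ k"
      using Suc.prems by (intro Suc.IH) (auto simp: xs')
    then show ?thesis
      unfolding vT using path_detach_last(2)[of ws v z] Suc.prems(1) xs' by metis
  qed
  ultimately show ?case
    using \<open>x \<noteq> z\<close> by (simp add: shelling_count_Suc vT leaves)
qed

section \<open>Forks have an odd number of shellings\<close>

text \<open>The first two entries are the twin leaves of the fork, and both hang on the third. A list of
  three entries gives a path with the third entry in the middle, which starts the induction on
  forks; shorter lists are too short for a fork and give the path.\<close>

fun fork_edges :: "'a list \<Rightarrow> 'a set set" where
  "fork_edges (x # y # z # ws) = insert {x, z} (path_edges (y # z # ws))"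
| "fork_edges xs = path_edges xs"

lemma Union_fork_edges: "\<Union> (fork_edges xs) \<subseteq> set xs"
proof (cases xs rule: fork_edges.cases)
  case (1 x y z ws)
  then show ?thesis using Union_path_edges[of "y # z # ws"] by auto
qed auto

lemma fork_detach_twin:
  assumes "distinct (x # y # z # ws)"
  shows "leaf (list_graph fork_edges (x # y # z # ws)) x"
    and "induced (list_graph fork_edges (x # y # z # ws)) (set (x # y # z # ws) - {x})
      = list_graph path_edges (y # z # ws)"
  using leaf_attached[of "path_edges (y # z # ws)" "set (y # z # ws)" x z]
    induced_detach[of "path_edges (y # z # ws)" "set (y # z # ws)" x z]
    Union_path_edges[of "y # z # ws"] assms
  by (simp_all add: list_graph_def insert_commute)

lemma fork_swap_twins:
  "list_graph fork_edges (x # y # z # ws) = list_graph fork_edges (y # x # z # ws)"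
  by (simp add: list_graph_def insert_commute)

lemma fork_detach_last:
  assumes "distinct (x # y # zs @ [v, w])"
  shows "leaf (list_graph fork_edges (x # y # zs @ [v, w])) w"
    and "induced (list_graph fork_edges (x # y # zs @ [v, w])) (set (x # y # zs @ [v, w]) - {w})
      = list_graph fork_edges (x # y # zs @ [v])"
proof -
  have edges: "fork_edges (x # y # zs @ [v, w]) = insert {v, w} (fork_edges (x # y # zs @ [v]))"
  proof (cases zs)
    case (Cons z zs')
    then show ?thesis using path_edges_snoc[of "y # z # zs'" v w] by (auto simp: insert_commute)
  qed auto
  have set: "set (x # y # zs @ [v, w]) = insert w (set (x # y # zs @ [v]))" by auto
  have sub: "\<Union> (fork_edges (x # y # zs @ [v])) \<subseteq> set (x # y # zs @ [v])"
    by (rule Union_fork_edges)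
  have w: "w \<notin> set (x # y # zs @ [v])" using assms by auto
  show "leaf (list_graph fork_edges (x # y # zs @ [v, w])) w"
    unfolding list_graph_def edges set by (rule leaf_attached[OF sub w])
  show "induced (list_graph fork_edges (x # y # zs @ [v, w])) (set (x # y # zs @ [v, w]) - {w})
      = list_graph fork_edges (x # y # zs @ [v])"
    unfolding list_graph_def edges set by (rule induced_detach[OF sub w])
qed

text \<open>Of the shellings with \<open>k + 1\<close> removals, \<open>2 * 2 ^ k\<close> begin with one of the twins, and by
  induction an odd number begin with the far end. The bound on \<open>k\<close> keeps the far end different from the vertex that carries
  the twins, which is not a leaf.\<close>

lemma shelling_count_fork:
  assumes "distinct xs" "k + 3 \<le> length xs"
  shows "odd (shelling_count (list_graph fork_edges xs) k)"
  using assms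
proof (induction k arbitrary: xs)
  case 0
  show ?case by (simp add: shelling_count_0)
next
  case (Suc k)
  let ?T = "list_graph fork_edges xs"
  obtain x y us where us: "xs = x # y # us"
    using Suc.prems(2) by (auto simp: Suc_le_length_iff numeral_3_eq_3)
  obtain zs v w where zs: "us = zs @ [v, w]"
    using two_last_entries[of us] Suc.prems(2) us by auto
  have xs: "xs = x # y # zs @ [v, w]" by (simp add: us zs)
  obtain z ws where z: "us = z # ws" using zs by (metis append_is_Nil_conv list.distinct(1) list.exhaust)
  have dist: "distinct (x # y # z # ws)" "distinct (y # x # z # ws)"
    using Suc.prems(1) us z by auto
  have twin: "leaf ?T y" "induced ?T (set xs - {y}) = list_graph path_edges (x # z # ws)"
    using fork_detach_twin[OF dist(2)] fork_swap_twins[of x y z ws] us z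
    by (simp_all add: insert_commute)
  have leaves: "{v. leaf ?T v} = {x, y, w}"
  proof -
    have "\<not> leaf ?T a" if a: "a \<noteq> x" "a \<noteq> y" "a \<noteq> w" for a
    proof (cases "a \<in> set xs")
      case True
      obtain b c where "{b, a} \<in> path_edges (y # us)" "{a, c} \<in> path_edges (y # us)" "b \<noteq> c"
      proof (rule path_interior_neighbours)
        show "distinct (y # us)" using Suc.prems(1) us by auto
        show "a \<in> set (y # us)" using True a us by auto
        show "a \<noteq> hd (y # us)" using a by simp
        show "a \<noteq> last (y # us)" using a by (simp add: zs)
      qed
      then show ?thesis by (intro not_leaf_two_neighbours) (auto simp: list_graph_def us z)
    qed (simp add: leaf_def list_graph_def)
    moreover have "leaf ?T x" using fork_detach_twin(1)[OF dist(1)] us z by simp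
    moreover have "leaf ?T w" using fork_detach_last(1) Suc.prems(1) by (metis xs)
    ultimately show ?thesis using twin(1) by blast
  qed
  have ne: "x \<noteq> y" "x \<noteq> w" "y \<noteq> w" using Suc.prems(1) by (auto simp: xs)
  have vT: "verts ?T = set xs" by (simp add: list_graph_def)
  have len: "k + 2 \<le> length (y # z # ws)" "k + 2 \<le> length (x # z # ws)"
    using Suc.prems(2) us z by auto
  have "induced ?T (set xs - {x}) = list_graph path_edges (y # z # ws)"
    using fork_detach_twin(2)[OF dist(1)] us z by simp
  then have "shelling_count (induced ?T (set xs - {x})) k = 2 ^ k"
    using shelling_count_path[OF _ len(1)] dist by simp
  moreover have "shelling_count (induced ?T (set xs - {y})) k = 2 ^ k"
    using shelling_count_path[OF _ len(2)] dist by (simp add: twin(2))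
  moreover have "odd (shelling_count (induced ?T (set xs - {w})) k)"
  proof -
    have "odd (shelling_count (list_graph fork_edges (x # y # zs @ [v])) k)"
      using Suc.prems by (intro Suc.IH) (auto simp: xs)
    then show ?thesis using fork_detach_last(2)[of x y zs v w] Suc.prems(1) xs by metis
  qed
  ultimately show ?case
    using ne by (simp add: shelling_count_Suc vT leaves)
qed

section \<open>Forests with prescribed component sizes\<close>

definition adjacent_by :: "'a set set \<Rightarrow> ('a \<times> 'a) set" where
  "adjacent_by E = {(u, v). {u, v} \<in> E}"

definition connects :: "'a set set \<Rightarrow> 'a set \<Rightarrow> bool" where
  "connects E V \<longleftrightarrow> V \<times> V \<subseteq> (adjacent_by E)\<^sup>*"

lemma connects_insert:
  assumes "connects E V" "u \<in> V"
  shows "connects (insert {u, v} E) (insert v V)"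
proof -
  let ?R = "(adjacent_by (insert {u, v} E))\<^sup>*"
  have "(adjacent_by E)\<^sup>* \<subseteq> ?R"
    by (rule rtrancl_mono) (auto simp: adjacent_by_def)
  then have V: "(a, b) \<in> ?R" if "a \<in> V" "b \<in> V" for a b
    using assms(1) that by (auto simp: connects_def)
  have "(u, v) \<in> ?R" "(v, u) \<in> ?R"
    by (auto intro!: r_into_rtrancl simp: adjacent_by_def insert_commute)
  then have "(a, u) \<in> ?R \<and> (u, a) \<in> ?R" if "a \<in> insert v V" for a
    using that V assms(2) by auto
  then show ?thesis
    unfolding connects_def by (auto intro: rtrancl_trans)
qed

lemma connects_path: "connects (path_edges xs) (set xs)"
proof (induction xs rule: path_edges.induct)
  case (1 x y zs)
  then show ?case using connects_insert[OF 1, of y x] by (simp add: insert_commute)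
qed (auto simp: connects_def)

lemma connects_fork: "connects (fork_edges xs) (set xs)"
proof (cases xs rule: fork_edges.cases)
  case (1 x y z ws)
  then show ?thesis
    using connects_insert[OF connects_path[of "y # z # ws"], of z x] by (simp add: insert_commute)
qed (use connects_path[of xs] in simp_all)

text \<open>The common features of paths and forks from which the forests are assembled. Acyclicity enters
  through the bound on larger neighbours: it concerns one vertex at a time, so it passes to a
  disjoint union without first confining a cycle to one block.\<close>

locale increasing_tree =
  fixes E :: "nat list \<Rightarrow> nat set set"
  assumes edge_subset: "e \<in> E xs \<Longrightarrow> e \<subseteq> set xs"
    and card_edge: "distinct xs \<Longrightarrow> e \<in> E xs \<Longrightarrow> card e = 2"
    and connects_entries: "connects (E xs) (set xs)"
    and unique: "sorted_wrt (<) xs \<Longrightarrow> larger_neighbours_unique (E xs)"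
begin

definition forest :: "nat list list \<Rightarrow> nat graph" where
  "forest Ls = \<lparr>verts = set (concat Ls), edges = (\<Union>L\<in>set Ls. E L)\<rparr>"

lemma simple_graph_forest: "distinct (concat Ls) \<Longrightarrow> simple_graph (forest Ls)"
  using edge_subset card_edge by (force simp: simple_graph_def forest_def distinct_concat_iff)

text \<open>That the concatenation increases strictly says at once that every block increases and that
  different blocks are disjoint.\<close>

context
  fixes Ls :: "nat list list"
  assumes increasing: "sorted_wrt (<) (concat Ls)" and nonempty: "[] \<notin> set Ls"
begin

lemma distinct_concat_blocks: "distinct (concat Ls)"
  using increasing by (simp add: strict_sorted_iff)

lemma sorted_block: "L \<in> set Ls \<Longrightarrow> sorted_wrt (<) L"
  using increasing by (auto dest!: split_list simp: sorted_wrt_append)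

lemma blocks_disjoint:
  assumes "L \<in> set Ls" "M \<in> set Ls" "v \<in> set L" "v \<in> set M"
  shows "L = M"
  using distinct_concat_blocks assms by (auto simp: distinct_concat_iff)

lemma forest_edge_in_block:
  assumes "e \<in> edges (forest Ls)" "u \<in> e" "L \<in> set Ls" "u \<in> set L"
  shows "e \<in> E L"
proof -
  obtain M where "M \<in> set Ls" "e \<in> E M" using assms(1) by (auto simp: forest_def)
  then show ?thesis using assms blocks_disjoint edge_subset by blast
qed

lemma acyclic_forest: "acyclic_graph (forest Ls)"
proof (intro acyclic_graphI, unfold larger_neighbours_unique_def, intro allI impI)
  fix u v w
  assume e: "{u, v} \<in> edges (forest Ls)" "{u, w} \<in> edges (forest Ls)" and less: "u < v" "u < w"
  then obtain L where L: "L \<in> set Ls" "{u, v} \<in> E L" by (auto simp: forest_def)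
  then have "u \<in> set L" using edge_subset by blast
  then have "{u, w} \<in> E L" using forest_edge_in_block e(2) L(1) by blast
  then show "v = w" using larger_neighbours_uniqueD[OF unique[OF sorted_block]] L less by blast
qed

lemma components_forest: "components (forest Ls) = set ` set Ls"
proof (rule components_eqI)
  show "\<Union> (set ` set Ls) = verts (forest Ls)" by (simp add: forest_def)
  show "{} \<notin> set ` set Ls" using nonempty by auto
next
  fix B u v assume "B \<in> set ` set Ls" and uv: "u \<in> B" "v \<in> B"
  then obtain L where L: "L \<in> set Ls" "B = set L" by blast
  have "(adjacent_by (E L))\<^sup>* \<subseteq> (adjacency (forest Ls))\<^sup>*"
    using L(1) by (intro rtrancl_mono) (auto simp: adjacent_by_def adjacency_def forest_def)
  then show "(u, v) \<in> (adjacency (forest Ls))\<^sup>*"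
    using connects_entries[of L] uv L(2) by (auto simp: connects_def)
next
  fix B u v assume "B \<in> set ` set Ls" "u \<in> B" "{u, v} \<in> edges (forest Ls)"
  then show "v \<in> B" using forest_edge_in_block edge_subset by blast
qed

lemma induced_forest:
  assumes "L \<in> set Ls"
  shows "induced (forest Ls) (set L) = list_graph E L"
proof -
  have nonempty_edge: "e \<noteq> {}" if "e \<in> edges (forest Ls)" for e
    using simple_graph_forest[OF distinct_concat_blocks] that by (auto simp: simple_graph_def)
  have "{e \<in> edges (forest Ls). e \<subseteq> set L} = E L"
  proof (intro equalityI subsetI)
    fix e assume "e \<in> {e \<in> edges (forest Ls). e \<subseteq> set L}"
    then obtain u where "e \<in> edges (forest Ls)" "u \<in> e" "u \<in> set L"
      using nonempty_edge by blast
    then show "e \<in> E L" using forest_edge_in_block assms by blast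
  next
    fix e assume "e \<in> E L"
    then show "e \<in> {e \<in> edges (forest Ls). e \<subseteq> set L}"
      using assms edge_subset by (auto simp: forest_def)
  qed
  then show ?thesis by (simp add: induced_def list_graph_def)
qed

lemma component_partition_forest: "component_partition (forest Ls) = mset (map length Ls)"
proof -
  have d: "distinct L" if "L \<in> set Ls" for L
    using that distinct_concat_blocks by (auto simp: distinct_concat_iff)
  have "removeAll [] Ls = Ls" using nonempty by (simp add: removeAll_id)
  then have "distinct Ls"
    using distinct_concat_blocks by (simp add: distinct_concat_iff)
  moreover have "inj_on set (set Ls)"
  proof (rule inj_onI)
    fix L M assume LM: "L \<in> set Ls" "M \<in> set Ls" "set L = set M"
    then have "L \<noteq> []" using nonempty by metis
    then obtain v where "v \<in> set L" by (meson last_in_set)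
    then show "L = M" using LM blocks_disjoint by blast
  qed
  ultimately have "mset_set (set ` set Ls) = image_mset set (mset Ls)"
    by (simp add: image_mset_mset_set[symmetric] mset_set_set)
  then have "component_partition (forest Ls) = image_mset (\<lambda>L. card (set L)) (mset Ls)"
    by (simp add: component_partition_def components_forest multiset.map_comp comp_def)
  also have "\<dots> = image_mset length (mset Ls)"
    using d by (intro image_mset_cong) (simp add: distinct_card)
  finally show ?thesis by simp
qed

lemma shellings_forest:
  "shellings (forest Ls) = (\<Prod>C\<in>set ` set Ls. tree_shellings (induced (forest Ls) C))"
  by (simp add: shellings_def acyclic_forest components_forest)

lemma tree_shellings_block:
  assumes "L \<in> set Ls"
  shows "tree_shellings (induced (forest Ls) (set L)) = shelling_count (list_graph E L) (length L - 3)"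
proof -
  have "distinct L" using assms distinct_concat_blocks by (auto simp: distinct_concat_iff)
  then show ?thesis
    using assms by (simp add: induced_forest tree_shellings_eq_shelling_count list_graph_def distinct_card)
qed

end

end

lemma card_path_edge: "distinct xs \<Longrightarrow> e \<in> path_edges xs \<Longrightarrow> card e = 2"
  by (induction xs rule: path_edges.induct) auto

lemma path_larger_neighbours_unique:
  "sorted_wrt (<) xs \<Longrightarrow> larger_neighbours_unique (path_edges xs)"
proof (induction xs rule: path_edges.induct)
  case (1 x y zs)
  then have "larger_neighbours_unique (insert {x, y} (path_edges (y # zs)))"
    using Union_path_edges[of "y # zs"] by (intro larger_neighbours_unique_insert) auto
  then show ?case by simp
qed (simp_all add: larger_neighbours_unique_def)

lemma fork_larger_neighbours_unique:
  assumes "sorted_wrt (<) xs"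
  shows "larger_neighbours_unique (fork_edges xs)"
proof (cases xs rule: fork_edges.cases)
  case (1 x y z ws)
  then have "larger_neighbours_unique (insert {x, z} (path_edges (y # z # ws)))"
    using assms Union_path_edges[of "y # z # ws"]
    by (intro larger_neighbours_unique_insert path_larger_neighbours_unique) auto
  then show ?thesis by (simp add: 1)
qed (use path_larger_neighbours_unique[OF assms] in simp_all)

lemma card_fork_edge:
  assumes "distinct xs" "e \<in> fork_edges xs"
  shows "card e = 2"
proof (cases xs rule: fork_edges.cases)
  case (1 x y z ws)
  then show ?thesis using assms card_path_edge[of "y # z # ws" e] by auto
qed (use assms card_path_edge[of xs e] in auto)

interpretation paths: increasing_tree path_edges
proof (unfold_locales, goal_cases)
  case (1 e xs)
  then show ?case using Union_path_edges[of xs] by auto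
next
  case (2 xs e)
  then show ?case by (rule card_path_edge)
next
  case (3 xs)
  show ?case by (rule connects_path)
next
  case (4 xs)
  then show ?case by (rule path_larger_neighbours_unique)
qed

interpretation forks: increasing_tree fork_edges
proof (unfold_locales, goal_cases)
  case (1 e xs)
  then show ?case using Union_fork_edges[of xs] by auto
next
  case (2 xs e)
  then show ?case by (rule card_fork_edge)
next
  case (3 xs)
  show ?case by (rule connects_fork)
next
  case (4 xs)
  then show ?case by (rule fork_larger_neighbours_unique)
qed

text \<open>Consecutive intervals serve as the vertex sets of the components.\<close>

lemma split_into_blocks: "\<exists>Ls. concat Ls = [a..<a + sum_list ms] \<and> map length Ls = ms"
proof (induction ms arbitrary: a)
  case Nil
  show ?case by (intro exI[of _ "[]"]) simp
next
  case (Cons m ms)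
  from Cons[of "a + m"] obtain Ls
    where "concat Ls = [a + m..<a + m + sum_list ms]" "map length Ls = ms" by blast
  moreover have "[a..<a + sum_list (m # ms)] = [a..<a + m] @ [a + m..<a + m + sum_list ms]"
    using upt_add_eq_append[of a "a + m" "sum_list ms"] by (simp add: add.assoc)
  ultimately show ?case
    by (intro exI[of _ "[a..<a + m] # Ls"]) simp
qed

lemma coprime_forests:
  assumes "p \<in> partitions n"
  obtains G H :: "nat graph" where
    "simple_graph G" "verts G = {..<n}" "component_partition G = p"
    "simple_graph H" "verts H = {..<n}" "component_partition H = p"
    "coprime (shellings G) (shellings H)"
proof -
  obtain ms where ms: "mset ms = p" using ex_mset by blast
  have pos: "0 \<notin> set ms" and sum: "sum_list ms = n"
    using assms ms by (auto simp: partitions_def sum_mset_sum_list[symmetric])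
  obtain Ls where concat: "concat Ls = [0..<n]" and len: "map length Ls = ms"
    using split_into_blocks[of 0 ms] sum by auto
  have inc: "sorted_wrt (<) (concat Ls)" by (simp add: concat)
  have ne: "[] \<notin> set Ls" using pos len by force
  have dist: "distinct L" if "L \<in> set Ls" for L
    using that paths.distinct_concat_blocks[OF inc ne] by (auto simp: distinct_concat_iff)
  have path: "coprime (tree_shellings (induced (paths.forest Ls) C)) q"
    if C: "C \<in> set ` set Ls" "odd q" for C and q :: nat
  proof -
    obtain L where L: "L \<in> set Ls" "C = set L" using C(1) by blast
    have "shelling_count (list_graph path_edges L) (length L - 3) = 2 ^ (length L - 3)"
    proof (cases "length L \<le> 3")
      case True
      then show ?thesis by (simp add: shelling_count_0)
    qed (use L dist in \<open>simp add: shelling_count_path\<close>)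
    then show ?thesis
      using C(2) by (simp add: L(2) paths.tree_shellings_block[OF inc ne L(1)])
  qed
  have fork: "odd (tree_shellings (induced (forks.forest Ls) C))" if C: "C \<in> set ` set Ls" for C
  proof -
    obtain L where L: "L \<in> set Ls" "C = set L" using C by blast
    have "odd (shelling_count (list_graph fork_edges L) (length L - 3))"
    proof (cases "length L \<le> 3")
      case True
      then show ?thesis by (simp add: shelling_count_0)
    qed (use L dist in \<open>simp add: shelling_count_fork\<close>)
    then show ?thesis by (simp add: L(2) forks.tree_shellings_block[OF inc ne L(1)])
  qed
  have "odd (shellings (forks.forest Ls))"
    using fork by (simp add: forks.shellings_forest[OF inc ne] even_prod_iff)
  then have "coprime (shellings (paths.forest Ls)) (shellings (forks.forest Ls))"
    using path by (auto simp: paths.shellings_forest[OF inc ne] intro!: prod_coprime_left)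
  then show thesis
  proof (rule that[rotated -1])
    show "simple_graph (paths.forest Ls)" "simple_graph (forks.forest Ls)"
      using paths.distinct_concat_blocks[OF inc ne]
      by (auto intro: paths.simple_graph_forest forks.simple_graph_forest)
    show "verts (paths.forest Ls) = {..<n}" "verts (forks.forest Ls) = {..<n}"
      unfolding paths.forest_def forks.forest_def concat by auto
    show "component_partition (paths.forest Ls) = p" "component_partition (forks.forest Ls) = p"
      unfolding paths.component_partition_forest[OF inc ne]
        forks.component_partition_forest[OF inc ne] len ms by simp_all
  qed
qed

section \<open>The integral span of the flag vectors\<close>

text \<open>Fixing the vertex set makes the family finite, so that all linear combinations can share one
  index set; it is still closed under subgraphs.\<close>

definition labelled_graphs :: "nat \<Rightarrow> nat graph set" where
  "labelled_graphs n = {G. simple_graph G \<and> verts G = {..<n}}"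

lemma graph_eqI: "verts H = verts G \<Longrightarrow> edges H = edges G \<Longrightarrow> H = (G :: 'v graph)"
  by (rule graph.equality) simp_all

lemma labelled_graphs_subset: "labelled_graphs n \<subseteq> graphs_on n"
  unfolding labelled_graphs_def graphs_on_def by clarsimp

lemma finite_labelled_graphs: "finite (labelled_graphs n)"
proof (rule finite_surj)
  show "finite (Pow (Pow {..<n}))" by simp
  show "labelled_graphs n \<subseteq> (\<lambda>E. \<lparr>verts = {..<n}, edges = E\<rparr>) ` Pow (Pow {..<n})"
  proof
    fix G assume "G \<in> labelled_graphs n"
    then have "edges G \<in> Pow (Pow {..<n})" "G = \<lparr>verts = {..<n}, edges = edges G\<rparr>"
      by (auto simp: labelled_graphs_def simple_graph_def intro!: graph_eqI)
    then show "G \<in> (\<lambda>E. \<lparr>verts = {..<n}, edges = E\<rparr>) ` Pow (Pow {..<n})" by (rule rev_image_eqI)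
  qed
qed

lemma subgraphs_labelled: "G \<in> labelled_graphs n \<Longrightarrow> subgraphs G \<subseteq> labelled_graphs n"
  unfolding labelled_graphs_def subgraphs_def simple_graph_def
  by clarsimp blast

definition flag_span :: "nat \<Rightarrow> (nat multiset \<Rightarrow>\<^sub>0 int) set" where
  "flag_span n = {x. \<exists>a. x = (\<Sum>G\<in>labelled_graphs n. frag_cmul (a G) (concise_flag_vector G))}"

lemma flag_span_zero: "0 \<in> flag_span n"
  unfolding flag_span_def by (auto intro!: exI[of _ "\<lambda>_. 0"])

lemma flag_span_add:
  assumes "x \<in> flag_span n" "y \<in> flag_span n"
  shows "x + y \<in> flag_span n"
proof -
  obtain a b where "x = (\<Sum>G\<in>labelled_graphs n. frag_cmul (a G) (concise_flag_vector G))"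
    "y = (\<Sum>G\<in>labelled_graphs n. frag_cmul (b G) (concise_flag_vector G))"
    using assms by (auto simp: flag_span_def)
  then show ?thesis
    unfolding flag_span_def
    by (auto intro!: exI[of _ "\<lambda>G. a G + b G"] simp: frag_cmul_distrib sum.distrib)
qed

lemma flag_span_cmul:
  assumes "x \<in> flag_span n"
  shows "frag_cmul c x \<in> flag_span n"
proof -
  obtain a where "x = (\<Sum>G\<in>labelled_graphs n. frag_cmul (a G) (concise_flag_vector G))"
    using assms by (auto simp: flag_span_def)
  then show ?thesis
    unfolding flag_span_def
    by (auto intro!: exI[of _ "\<lambda>G. c * a G"] simp: frag_cmul_sum)
qed

lemma flag_span_diff: "x \<in> flag_span n \<Longrightarrow> y \<in> flag_span n \<Longrightarrow> x - y \<in> flag_span n"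
  using flag_span_add[of x n "- y"] flag_span_cmul[of y n "-1"] by simp

lemma flag_span_sum: "(\<And>i. i \<in> A \<Longrightarrow> f i \<in> flag_span n) \<Longrightarrow> (\<Sum>i\<in>A. f i) \<in> flag_span n"
  by (induction A rule: infinite_finite_induct) (auto simp: flag_span_zero flag_span_add)

lemma concise_flag_vector_in_flag_span:
  assumes "G \<in> labelled_graphs n"
  shows "concise_flag_vector G \<in> flag_span n"
proof -
  have "concise_flag_vector G = (\<Sum>H\<in>labelled_graphs n. if H = G then concise_flag_vector H else 0)"
    using assms by (simp add: finite_labelled_graphs)
  also have "\<dots> = (\<Sum>H\<in>labelled_graphs n. frag_cmul (if H = G then 1 else 0) (concise_flag_vector H))"
    by (intro sum.cong) auto
  finally show ?thesis
    unfolding flag_span_def mem_Collect_eq by (rule exI[of _ "\<lambda>H. if H = G then 1 else 0"])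
qed

text \<open>Solve the defining sum of the flag vector for the term of \<open>G\<close> itself: its coefficient is 1,
  and all other terms belong to graphs with fewer edges.\<close>

lemma shellings_in_flag_span:
  assumes "G \<in> labelled_graphs n"
  shows "frag_cmul (int (shellings G)) (frag_of (component_partition G)) \<in> flag_span n"
  using assms
proof (induction "card (edges G)" arbitrary: G rule: less_induct)
  case less
  let ?t = "\<lambda>H. frag_cmul (int (shellings H)) (frag_of (component_partition H))"
  have fin: "finite (subgraphs G)"
    using subgraphs_labelled[OF less.prems] finite_labelled_graphs finite_subset by blast
  have finE: "finite (edges G)"
    using less.prems finite_subset[of "edges G" "Pow (verts G)"]
    by (auto simp: labelled_graphs_def simple_graph_def)
  have "G \<in> subgraphs G" by (simp add: subgraphs_def)
  then have "?t G = concise_flag_vector G - (\<Sum>H\<in>subgraphs G - {G}. ?t H)"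
    using fin by (simp add: concise_flag_vector_def sum_diff1)
  moreover have "?t H \<in> flag_span n" if H: "H \<in> subgraphs G - {G}" for H
  proof (rule less.hyps)
    have "edges H \<subset> edges G"
      using H graph_eqI[of H G] by (auto simp: subgraphs_def)
    then show "card (edges H) < card (edges G)" using finE by (simp add: psubset_card_mono)
    show "H \<in> labelled_graphs n" using H subgraphs_labelled[OF less.prems] by blast
  qed
  ultimately show ?case
    by (simp only:) (intro flag_span_diff flag_span_sum concise_flag_vector_in_flag_span less.prems)
qed

lemma partition_in_flag_span:
  assumes "p \<in> partitions n"
  shows "frag_of p \<in> flag_span n"
proof -
  obtain G H :: "nat graph" where
    G: "simple_graph G" "verts G = {..<n}" "component_partition G = p" and
    H: "simple_graph H" "verts H = {..<n}" "component_partition H = p" and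
    cop: "coprime (shellings G) (shellings H)"
    using coprime_forests[OF assms] .
  obtain u v :: int where "u * int (shellings G) + v * int (shellings H) = 1"
    using bezout_int[of "int (shellings G)" "int (shellings H)"] cop by auto
  then have "frag_of p = frag_cmul u (frag_cmul (int (shellings G)) (frag_of p))
      + frag_cmul v (frag_cmul (int (shellings H)) (frag_of p))"
    by (simp flip: frag_cmul_distrib)
  moreover have "frag_cmul (int (shellings G)) (frag_of p) \<in> flag_span n"
    "frag_cmul (int (shellings H)) (frag_of p) \<in> flag_span n"
    using shellings_in_flag_span[of G n] shellings_in_flag_span[of H n] G H
    by (auto simp: labelled_graphs_def)
  ultimately show ?thesis by (metis flag_span_add flag_span_cmul)
qed

lemma concise_flag_vector_in_carrier:
  assumes "G \<in> graphs_on n"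
  shows "concise_flag_vector G \<in> carrier (free_Abelian_group (partitions n))"
proof -
  have "component_partition H \<in> partitions n" if "H \<in> subgraphs G" for H
    using component_partition_in_partitions[of H] assms that
    by (auto simp: graphs_on_def simple_graph_def subgraphs_def)
  then have "Poly_Mapping.keys (frag_cmul (int (shellings H)) (frag_of (component_partition H)))
      \<subseteq> partitions n" if "H \<in> subgraphs G" for H
    using that keys_cmul by fastforce
  then have "Poly_Mapping.keys (concise_flag_vector G) \<subseteq> partitions n"
    unfolding concise_flag_vector_def
    by (intro order_trans[OF keys_sum]) blast
  then show ?thesis by simp
qed

theorem theorem27:
  fixes n :: nat
  assumes "1 \<le> n"
  shows "concise_flag_vector ` (graphs_on n :: nat graph set)
           \<subseteq> carrier (free_Abelian_group (partitions n)) \<and>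
    (\<forall>x \<in> carrier (free_Abelian_group (partitions n)).
       \<exists>(S :: nat graph set) (a :: nat graph \<Rightarrow> int).
         finite S \<and> S \<subseteq> graphs_on n \<and>
         x = (\<Sum>G\<in>S. frag_cmul (a G) (concise_flag_vector G)))"
proof (intro conjI ballI)
  show "concise_flag_vector ` (graphs_on n :: nat graph set)
      \<subseteq> carrier (free_Abelian_group (partitions n))"
    using concise_flag_vector_in_carrier by blast
next
  fix x assume "x \<in> carrier (free_Abelian_group (partitions n))"
  then have "Poly_Mapping.keys x \<subseteq> partitions n" by simp
  then have "x \<in> flag_span n"
    by (induction rule: frag_induction)
       (auto intro: flag_span_zero partition_in_flag_span flag_span_diff)
  then obtain a where "x = (\<Sum>G\<in>labelled_graphs n. frag_cmul (a G) (concise_flag_vector G))"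
    by (auto simp: flag_span_def)
  moreover have "labelled_graphs n \<subseteq> graphs_on n"
    by (rule labelled_graphs_subset)
  ultimately show "\<exists>(S :: nat graph set) (a :: nat graph \<Rightarrow> int).
      finite S \<and> S \<subseteq> graphs_on n \<and> x = (\<Sum>G\<in>S. frag_cmul (a G) (concise_flag_vector G))"
    by (intro exI[of _ "labelled_graphs n"] exI[of _ a] conjI finite_labelled_graphs)
qed

end
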